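(* For every integer $k\geq 2$, every finite digraph $D$ admits a $\frac{1}{k}$-majority colouring using $2k$ colours; that is, there is a map $c:V(D)\to\{1,2,\dots,2k\}$ such that for every vertex $v$, the number of out-neighbours $w$ of $v$ with $c(w)=c(v)$ is at most $d^{+}(v)/k$, where $d^{+}(v)$ is the out-degree of $v$.
   Context: A $\frac{1}{k}$-majority colouring of a digraph is a colouring of its vertices such that each vertex receives the same colour as at most a $1/k$ proportion of its out-neighbours. A digraph is $\frac{1}{k}$-majority $m$-colourable if it has a $\frac{1}{k}$-majority colouring using $m$ colours. *)

theory Defs
  imports Complex_Main "HOL-Library.FuncSet" "Graph_Theory.Digraph"
begin

definition out_neighbours :: "('a, 'b) pre_digraph \<Rightarrow> 'a \<Rightarrow> 'a set" where
  "out_neighbours D v = {w \<in> verts D. v \<rightarrow>\<^bsub>D\<^esub> w}"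

text \<open>
  The locale \<^locale>\<open>digraph\<close> excludes loops and parallel arcs (opposite arcs are allowed), so
  \<^const>\<open>out_degree\<close>, which counts arcs, is the number of out-neighbours. The inequality is
  written with real division; a vertex without out-neighbours satisfies it trivially.
\<close>

definition majority_colouring :: "nat \<Rightarrow> ('a, 'b) pre_digraph \<Rightarrow> ('a \<Rightarrow> 'c) \<Rightarrow> bool" where
  "majority_colouring k D c \<longleftrightarrow>
     (\<forall>v \<in> verts D.
        real (card {w \<in> out_neighbours D v. c w = c v}) \<le> real (out_degree D v) / real k)"

end

(*
  A random walk with a positive stationary distribution y turns the digraph into a weighted
  undirected graph in which the vertex v has weighted degree 2 y(v), half of it on out-arcs.
  A colouring with 2k colours of minimal monochromatic weight puts at most y(v)/k on the
  monochromatic edges at v, hence at most a 1/k proportion of the out-arcs of v is monochromatic.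
  For general digraphs a nonzero y >= 0 with yP <= y is enough: its support is closed under
  out-neighbours, so it can be coloured first, and one recurses on the remaining vertices, whose
  walk is substochastic. Such a y is found by eliminating states one at a time.
*)
theory Submission
  imports Defs
begin

text \<open>Induction on the number of states: the walk on \<open>insert x U\<close> is replaced by
  the walk watched only while it is in \<open>U\<close>, and the weight of \<open>x\<close> is
  recovered afterwards. An inequality \<open>yP \<le> y\<close> is the goal because rows may lose
  mass, in which case an exact stationary vector need not exist.\<close>

lemma substochastic_excessive_vector:
  fixes P :: "'a \<Rightarrow> 'a \<Rightarrow> real"
  assumes "finite U" "U \<noteq> {}"
    and "\<And>u v. u \<in> U \<Longrightarrow> v \<in> U \<Longrightarrow> 0 \<le> P u v"
    and "\<And>u. u \<in> U \<Longrightarrow> (\<Sum>v\<in>U. P u v) \<le> 1"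
  shows "\<exists>y. (\<forall>v\<in>U. 0 \<le> y v) \<and> (\<exists>v\<in>U. 0 < y v) \<and> (\<forall>v\<in>U. (\<Sum>u\<in>U. y u * P u v) \<le> y v)"
  using assms
proof (induction U arbitrary: P rule: finite_induct)
  case empty
  then show ?case by simp
next
  case (insert x U)
  note nonneg = insert.prems(2) and rows = insert.prems(3)
  have row: "P u x + (\<Sum>v\<in>U. P u v) \<le> 1" if "u \<in> insert x U" for u
    using rows[OF that] insert.hyps by simp
  have sum_nonneg_U: "0 \<le> (\<Sum>v\<in>U. P u v)" if "u \<in> insert x U" for u
    using nonneg that by (intro sum_nonneg) auto
  show ?case
  proof (cases "U = {} \<or> P x x \<ge> 1")
    \<comment> \<open>Here \<open>x\<close> is the only state or is absorbing, so the point mass at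
      \<open>x\<close> works.\<close>
    case True
    have "P x v = 0" if "v \<in> U" for v
    proof -
      have "P x x \<ge> 1" using True that by auto
      with row[of x] have "(\<Sum>v\<in>U. P x v) \<le> 0" by simp
      with sum_nonneg_U[of x] have "(\<Sum>v\<in>U. P x v) = 0" by simp
      then show ?thesis
        using that insert.hyps(1) nonneg by (subst (asm) sum_nonneg_eq_0_iff) auto
    qed
    moreover have "P x x \<le> 1" using row[of x] sum_nonneg_U[of x] by simp
    moreover have "(\<Sum>u\<in>insert x U. (if u = x then 1 else 0) * P u v) = P x v" for v
      using insert.hyps by (simp add: if_distrib[of "\<lambda>a. a * _"] sum.delta cong: if_cong)
    ultimately show ?thesis
      using insert.hyps by (intro exI[of _ "\<lambda>u. if u = x then 1 else 0"]) auto
  next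
    case False
    define d where "d = 1 - P x x"
    have d: "d > 0" using False by (simp add: d_def)
    \<comment> \<open>State elimination: a visit to \<open>x\<close> on the way from
      \<open>u\<close> to \<open>v\<close> is contracted into one step. The factor
      \<open>1 / d\<close> is the geometric series of the loops at \<open>x\<close>.\<close>
    define Q where "Q u v = P u v + P u x * P x v / d" for u v
    have Q_nonneg: "0 \<le> Q u v" if "u \<in> U" "v \<in> U" for u v
      unfolding Q_def using that nonneg d by (intro add_nonneg_nonneg divide_nonneg_pos) auto
    have Q_rows: "(\<Sum>v\<in>U. Q u v) \<le> 1" if u: "u \<in> U" for u
    proof -
      have "(\<Sum>v\<in>U. P x v) / d \<le> 1"
        using row[of x] d by (simp add: d_def)
      then have "P u x * ((\<Sum>v\<in>U. P x v) / d) \<le> P u x * 1"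
        using nonneg u by (intro mult_left_mono) auto
      then show ?thesis
        using row[of u] u
        by (simp add: Q_def sum.distrib sum_distrib_left sum_divide_distrib)
    qed
    obtain y where y0: "\<forall>v\<in>U. 0 \<le> y v" and y1: "\<exists>v\<in>U. 0 < y v"
      and y: "\<forall>v\<in>U. (\<Sum>u\<in>U. y u * Q u v) \<le> y v"
      using insert.IH[of Q] False Q_nonneg Q_rows by blast
    define s where "s = (\<Sum>u\<in>U. y u * P u x)"
    have s: "s \<ge> 0" unfolding s_def using y0 nonneg by (intro sum_nonneg) auto
    \<comment> \<open>\<open>s\<close> is the inflow to \<open>x\<close> from \<open>U\<close>. The
      value \<open>t = s / d\<close> solves \<open>t * P x x + s = t\<close>, which gives equality
      at \<open>x\<close>; with it the inflow to any \<open>v\<close> in \<open>U\<close> is exactly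
      that of \<open>y\<close> under \<open>Q\<close>.\<close>
    define z where "z = y(x := s / d)"
    have z: "(\<Sum>u\<in>insert x U. z u * P u v) = s / d * P x v + (\<Sum>u\<in>U. y u * P u v)" for v
    proof -
      have "(\<Sum>u\<in>U. z u * P u v) = (\<Sum>u\<in>U. y u * P u v)"
        using insert.hyps by (intro sum.cong) (auto simp: z_def)
      then show ?thesis using insert.hyps by (simp add: z_def)
    qed
    have "s / d * P x x + s = s / d"
      using d by (simp add: d_def field_simps)
    then have "(\<Sum>u\<in>insert x U. z u * P u x) \<le> z x"
      unfolding z by (simp add: z_def s_def)
    moreover have "(\<Sum>u\<in>insert x U. z u * P u v) \<le> z v" if v: "v \<in> U" for v
    proof -
      have "(\<Sum>u\<in>U. y u * Q u v) = s / d * P x v + (\<Sum>u\<in>U. y u * P u v)"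
        by (simp add: Q_def s_def distrib_left sum.distrib sum_distrib_left sum_divide_distrib
            mult_ac)
      moreover have "z v = y v" using v insert.hyps by (auto simp: z_def)
      ultimately show ?thesis unfolding z using bspec[OF y v] by simp
    qed
    ultimately show ?thesis
      using y0 y1 s d insert.hyps by (intro exI[of _ z]) (auto simp: z_def)
  qed
qed

text \<open>Local optimality: if the monochromatic weight is minimal among colourings that agree
  with \<open>c0\<close> off \<open>S\<close>, recolouring one vertex of \<open>S\<close> cannot
  lower it, so its own colour is the cheapest at that vertex and costs at most the average over
  \<open>C\<close>.\<close>

lemma min_weight_colouring:
  fixes s :: "'a \<Rightarrow> 'a \<Rightarrow> real" and c0 :: "'a \<Rightarrow> 'c"
  assumes T: "finite T" "S \<subseteq> T" and C: "finite C" "C \<noteq> {}"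
    and s0: "\<And>u v. 0 \<le> s u v" and sym: "\<And>u v. s u v = s v u" and irr: "\<And>v. s v v = 0"
  shows "\<exists>c. (\<forall>x. x \<notin> S \<longrightarrow> c x = c0 x) \<and> c \<in> S \<rightarrow> C \<and>
    (\<forall>v\<in>S. real (card C) * (\<Sum>w | w \<in> T \<and> c w = c v. s v w) \<le> (\<Sum>w\<in>T. s v w))"
proof -
  define F where "F = {c. (\<forall>x. x \<notin> S \<longrightarrow> c x = c0 x) \<and> c \<in> S \<rightarrow> C}"
  define E where "E c = (\<Sum>u\<in>T. \<Sum>w\<in>T. if c u = c w then s u w else 0)" for c :: "'a \<Rightarrow> 'c"
  \<comment> \<open>A member of \<open>F\<close> is determined by its restriction to
    \<open>S\<close>, so there are finitely many and a minimum exists.\<close>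
  have "F \<subseteq> (\<lambda>f x. if x \<in> S then f x else c0 x) ` (S \<rightarrow>\<^sub>E C)"
  proof
    fix c assume "c \<in> F"
    then have "c = (\<lambda>x. if x \<in> S then restrict c S x else c0 x)" "restrict c S \<in> S \<rightarrow>\<^sub>E C"
      by (auto simp: F_def)
    then show "c \<in> (\<lambda>f x. if x \<in> S then f x else c0 x) ` (S \<rightarrow>\<^sub>E C)" by (rule image_eqI)
  qed
  moreover have "finite S" using T finite_subset by blast
  ultimately have finF: "finite F"
    using C by (meson finite_PiE finite_imageI finite_subset)
  obtain a where "a \<in> C" using C by auto
  then have "(\<lambda>x. if x \<in> S then a else c0 x) \<in> F" by (auto simp: F_def)
  then have neF: "F \<noteq> {}" by auto
  obtain c where c: "c \<in> F" and min: "\<And>c'. c' \<in> F \<Longrightarrow> E c \<le> E c'"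
    using arg_min_if_finite[OF finF neF, of E] by (meson not_le)
  have "real (card C) * (\<Sum>w | w \<in> T \<and> c w = c v. s v w) \<le> (\<Sum>w\<in>T. s v w)" if v: "v \<in> S" for v
  proof -
    define A where "A j = (\<Sum>w | w \<in> T \<and> c w = j. s v w)" for j
    define R where "R = (\<Sum>u\<in>T-{v}. \<Sum>w\<in>T-{v}. if c u = c w then s u w else 0)"
    have vT: "v \<in> T" using v T by auto
    \<comment> \<open>\<open>E\<close> runs over ordered pairs, so each edge at \<open>v\<close>
      counts twice; \<open>R\<close> collects the pairs avoiding \<open>v\<close> and does not
      depend on \<open>j\<close>.\<close>
    have split: "E (c(v := j)) = 2 * A j + R" for j
    proof -
      define g where "g u w = (if (c(v := j)) u = (c(v := j)) w then s u w else 0)" for u w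
      have gsym: "g u w = g w u" for u w by (auto simp: g_def sym)
      have gv: "g v v = 0" by (simp add: g_def irr)
      have "E (c(v := j)) = (\<Sum>w\<in>T. g v w) + (\<Sum>u\<in>T-{v}. \<Sum>w\<in>T. g u w)"
        unfolding E_def g_def[symmetric] by (intro sum.remove T vT)
      also have "(\<Sum>u\<in>T-{v}. \<Sum>w\<in>T. g u w) = (\<Sum>u\<in>T-{v}. g u v + (\<Sum>w\<in>T-{v}. g u w))"
        by (intro sum.cong refl sum.remove T vT)
      also have "\<dots> = (\<Sum>u\<in>T-{v}. g v u) + (\<Sum>u\<in>T-{v}. \<Sum>w\<in>T-{v}. g u w)"
        by (simp add: sum.distrib gsym[of _ v])
      also have "(\<Sum>u\<in>T-{v}. \<Sum>w\<in>T-{v}. g u w) = R"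
        unfolding R_def by (intro sum.cong) (auto simp: g_def)
      also have "(\<Sum>u\<in>T-{v}. g v u) = (\<Sum>u\<in>T. g v u)"
        using T vT gv by (simp add: sum.remove)
      \<comment> \<open>The two sides give \<open>v\<close> itself different colours,
        \<open>j\<close> and \<open>c v\<close>; the term at \<open>v\<close> vanishes on both
        because \<open>s v v = 0\<close>.\<close>
      also have "(\<Sum>u\<in>T. g v u) = (\<Sum>w\<in>T. if c w = j then s v w else 0)"
        by (intro sum.cong) (auto simp: g_def irr)
      also have "\<dots> = A j"
        unfolding A_def using T by (simp add: sum.inter_filter)
      finally show ?thesis by (simp add: fun_upd_def)
    qed
    have le: "A (c v) \<le> A j" if "j \<in> C" for j
    proof -
      have "c(v := j) \<in> F" using c v that by (auto simp: F_def)
      then have "E c \<le> E (c(v := j))" by (rule min)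
      moreover have "E c = 2 * A (c v) + R" using split[of "c v"] by simp
      ultimately show ?thesis using split[of j] by simp
    qed
    have "real (card C) * A (c v) \<le> (\<Sum>j\<in>C. A j)"
      using sum_bounded_below[of C "A (c v)" A] le by simp
    also have "\<dots> = (\<Sum>w\<in>{w \<in> T. c w \<in> C}. s v w)"
      unfolding A_def using T C
      by (subst sum.group[symmetric, where T = C and g = c]) (auto intro!: sum.cong)
    \<comment> \<open>Only an inequality, since precoloured vertices of \<open>T - S\<close> may
      have colours outside \<open>C\<close>.\<close>
    also have "\<dots> \<le> (\<Sum>w\<in>T. s v w)"
      using T s0 by (intro sum_mono2) auto
    finally show ?thesis unfolding A_def .
  qed
  with c show ?thesis by (auto simp: F_def)
qed

text \<open>Strong induction on \<open>card U\<close>, with \<open>c0\<close> as a precolouring of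
  the rest. The support \<open>S\<close> of an excessive vector on \<open>U\<close> is coloured
  first; its vertices send no weight into \<open>U - S\<close>, so colouring that remainder later
  does not disturb them.\<close>

lemma substochastic_colouring_extension:
  fixes P :: "'a \<Rightarrow> 'a \<Rightarrow> real" and c0 :: "'a \<Rightarrow> 'c"
  assumes C: "finite C" "C \<noteq> {}"
    and V: "finite V" and U: "U \<subseteq> V"
    and P0: "\<And>u v. 0 \<le> P u v" and irr: "\<And>v. P v v = 0"
    and rows: "\<And>v. (\<Sum>w\<in>V. P v w) \<le> 1"
  shows "\<exists>c. (\<forall>x. x \<notin> U \<longrightarrow> c x = c0 x) \<and> c \<in> U \<rightarrow> C \<and>
    (\<forall>v\<in>U. (\<Sum>w | w \<in> V \<and> c w = c v. P v w) \<le> 2 / card C)"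
  using U
proof (induction "card U" arbitrary: U c0 rule: less_induct)
  case less
  show ?case
  proof (cases "U = {}")
    case True
    then show ?thesis by auto
  next
    case False
    have finU: "finite U" using less.prems V finite_subset by blast
    have "(\<Sum>v\<in>U. P u v) \<le> 1" for u
      using sum_mono2[OF V less.prems, of "P u"] P0 rows[of u] by (meson order_trans)
    then obtain y where y0: "\<forall>v\<in>U. 0 \<le> y v" and y1: "\<exists>v\<in>U. 0 < y v"
      and y: "\<forall>v\<in>U. (\<Sum>u\<in>U. y u * P u v) \<le> y v"
      using substochastic_excessive_vector[OF finU False, of P] P0 by blast
    define S where "S = {v \<in> U. 0 < y v}"
    have SU: "S \<subseteq> U" and finS: "finite S" and neS: "S \<noteq> {}"
      using y1 finU by (auto simp: S_def)
    \<comment> \<open>At \<open>w\<close> outside the support the total inflow is at most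
      \<open>y w = 0\<close>, so every summand, in particular the one from \<open>v\<close>, is
      zero.\<close>
    have closed: "P v w = 0" if "v \<in> S" "w \<in> U - S" for v w
    proof -
      have "y v * P v w \<le> (\<Sum>u\<in>U. y u * P u w)"
        using that finU y0 P0 SU
        by (intro member_le_sum[where f = "\<lambda>u. y u * P u w"]) auto
      also have "\<dots> \<le> 0" using y y0 that by (fastforce simp: S_def)
      finally show ?thesis
        using that P0[of v w] by (auto simp: S_def mult_le_0_iff)
    qed
    \<comment> \<open>\<open>q\<close> is the flow along arcs leaving \<open>S\<close>, and
      \<open>s\<close> its symmetrisation. Arcs starting outside \<open>S\<close> get weight zero,
      so that the inflow at a vertex of \<open>S\<close> is controlled by \<open>y\<close>.\<close>
    define q where "q u w = (if u \<in> S then y u * P u w else 0)" for u w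
    define s where "s u w = q u w + q w u" for u w
    have q0: "0 \<le> q u w" for u w using P0 by (auto simp: q_def S_def)
    \<comment> \<open>The vertices whose colours are settled once \<open>S\<close> is coloured:
      \<open>S\<close> itself and everything outside \<open>U\<close>.\<close>
    define T where "T = V - (U - S)"
    have T: "finite T" "S \<subseteq> T" using V SU less.prems by (auto simp: T_def)
    obtain c1 where c1: "\<forall>x. x \<notin> S \<longrightarrow> c1 x = c0 x" "c1 \<in> S \<rightarrow> C"
      and c1_le: "\<forall>v\<in>S. real (card C) * (\<Sum>w | w \<in> T \<and> c1 w = c1 v. s v w) \<le> (\<Sum>w\<in>T. s v w)"
    proof -
      have "0 \<le> s u v" "s u v = s v u" "s v v = 0" for u v
        using q0 by (simp_all add: s_def q_def irr)
      then show thesis using min_weight_colouring[OF T C, of s c0] that by blast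
    qed
    have "card (U - S) < card U"
      using SU neS finU by (intro psubset_card_mono) auto
    then obtain c where c: "\<forall>x. x \<notin> U - S \<longrightarrow> c x = c1 x" "c \<in> (U - S) \<rightarrow> C"
      and c_le: "\<forall>v\<in>U - S. (\<Sum>w | w \<in> V \<and> c w = c v. P v w) \<le> 2 / card C"
      using less.hyps[of "U - S" c1] less.prems by blast
    have "(\<Sum>w | w \<in> V \<and> c w = c v. P v w) \<le> 2 / card C" if v: "v \<in> S" for v
    proof -
      have yv: "y v > 0" and vU: "v \<in> U" using v by (auto simp: S_def)
      have K: "real (card C) > 0" using C by (simp add: card_gt_0_iff)
      \<comment> \<open>All out-weight of \<open>v\<close> lies in \<open>T\<close>, where the later
        colouring \<open>c\<close> agrees with \<open>c1\<close>.\<close>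
      have "w \<in> V \<Longrightarrow> P v w \<noteq> 0 \<Longrightarrow> w \<in> T" "w \<in> T \<Longrightarrow> c w = c1 w" "c v = c1 v" for w
        using v c(1) closed[OF v, of w] by (auto simp: T_def)
      then have "(\<Sum>w | w \<in> V \<and> c w = c v. P v w) = (\<Sum>w | w \<in> T \<and> c1 w = c1 v. P v w)"
        using V
        by (intro sum.mono_neutral_cong_right) (auto, auto simp: T_def)
      then have "y v * (\<Sum>w | w \<in> V \<and> c w = c v. P v w) = (\<Sum>w | w \<in> T \<and> c1 w = c1 v. q v w)"
        using v by (simp add: q_def sum_distrib_left)
      also have "\<dots> \<le> (\<Sum>w | w \<in> T \<and> c1 w = c1 v. s v w)"
        using q0 by (intro sum_mono) (simp add: s_def)
      finally have "real (card C) * (y v * (\<Sum>w | w \<in> V \<and> c w = c v. P v w)) \<le>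
          real (card C) * (\<Sum>w | w \<in> T \<and> c1 w = c1 v. s v w)"
        using K by simp
      also have "\<dots> \<le> (\<Sum>w\<in>T. s v w)" using c1_le v by blast
      \<comment> \<open>The weighted degree of \<open>v\<close> splits into outflow and inflow. Each
        is at most \<open>y v\<close>, the first by the row bound and the second by excessiveness;
        this is the source of the 2 in \<open>2 / card C\<close>.\<close>
      also have "\<dots> = y v * (\<Sum>w\<in>T. P v w) + (\<Sum>w\<in>T. q w v)"
        using v by (simp add: s_def sum.distrib sum_distrib_left q_def)
      also have "(\<Sum>w\<in>T. q w v) = (\<Sum>w\<in>S. y w * P w v)"
        using T by (intro sum.mono_neutral_cong_right) (auto simp: q_def)
      also have "(\<Sum>w\<in>S. y w * P w v) \<le> (\<Sum>w\<in>U. y w * P w v)"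
        using finU SU y0 P0 by (intro sum_mono2) auto
      also have "\<dots> \<le> y v" using y vU by blast
      also have "(\<Sum>w\<in>T. P v w) \<le> 1"
        using sum_mono2[OF V, of T "P v"] P0 rows[of v] by (force simp: T_def)
      finally have "y v * (card C * (\<Sum>w | w \<in> V \<and> c w = c v. P v w)) \<le> y v * 2"
        using yv by (simp add: mult_ac)
      then show ?thesis using yv K by (simp add: field_simps)
    qed
    then have "\<forall>v\<in>U. (\<Sum>w | w \<in> V \<and> c w = c v. P v w) \<le> 2 / card C"
      using c_le by blast
    moreover have "\<forall>x. x \<notin> U \<longrightarrow> c x = c0 x" "c \<in> U \<rightarrow> C"
      using c(1,2) c1 SU by auto (metis DiffI PiE c(1))
    ultimately show ?thesis by blast
  qed
qed

lemma (in digraph) out_degree_eq_card_out_neighbours: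
  "out_degree G v = card (out_neighbours G v)"
proof -
  have "inj_on (head G) (out_arcs G v)"
    using no_multi_arcs by (auto simp: inj_on_def arc_to_ends_def)
  moreover have "head G ` out_arcs G v = out_neighbours G v"
    by (auto simp: out_neighbours_def arcs_ends_def arc_to_ends_def)
  ultimately show ?thesis
    unfolding out_degree_def by (metis card_image)
qed

theorem theorem1:
  fixes k :: nat and D :: "('a, 'b) pre_digraph"
  assumes "k \<ge> 2" and "digraph D"
  shows "\<exists>c :: 'a \<Rightarrow> nat. c \<in> verts D \<rightarrow> {1..2 * k} \<and> majority_colouring k D c"
proof -
  interpret digraph D by fact
  define N where "N = out_neighbours D"
  have N: "N v \<subseteq> verts D" "v \<notin> N v" for v
    using adj_not_same by (auto simp: N_def out_neighbours_def)
  then have finN: "finite (N v)" for v using finite_verts finite_subset by blast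
  \<comment> \<open>Simple random walk on out-neighbours; a sink gets the zero row, so
    \<open>P\<close> is substochastic but not always stochastic.\<close>
  define P :: "'a \<Rightarrow> 'a \<Rightarrow> real" where "P v w = (if w \<in> N v then 1 / card (N v) else 0)" for v w
  have P_sum: "(\<Sum>w | w \<in> verts D \<and> Q w. P v w) = card {w \<in> N v. Q w} / card (N v)" for v Q
  proof -
    have "(\<Sum>w | w \<in> verts D \<and> Q w. P v w) = (\<Sum>w | w \<in> N v \<and> Q w. 1 / card (N v))"
      using N finite_verts by (intro sum.mono_neutral_cong_right) (auto simp: P_def)
    then show ?thesis by simp
  qed
  have rows: "(\<Sum>w\<in>verts D. P v w) \<le> 1" for v
    using P_sum[of v "\<lambda>_. True"] by simp
  \<comment> \<open>With \<open>U\<close> the whole vertex set no vertex is precoloured, and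
    \<open>2k\<close> colours turn the bound \<open>2 / card C\<close> into
    \<open>1 / k\<close>.\<close>
  have "\<exists>c. (\<forall>x. x \<notin> verts D \<longrightarrow> c x = 0) \<and> c \<in> verts D \<rightarrow> {1..2 * k} \<and>
      (\<forall>v\<in>verts D. (\<Sum>w | w \<in> verts D \<and> c w = c v. P v w) \<le> 2 / card {1..2 * k})"
    using assms(1) N rows
    by (intro substochastic_colouring_extension) (auto simp: P_def)
  then obtain c where c: "c \<in> verts D \<rightarrow> {1..2 * k}"
    and le: "\<And>v. v \<in> verts D \<Longrightarrow> card {w \<in> N v. c w = c v} / card (N v) \<le> 1 / k"
    by (auto simp: P_sum)
  have "real (card {w \<in> N v. c w = c v}) \<le> real (card (N v)) / k" if "v \<in> verts D" for v
  proof (cases "N v = {}")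
    case False
    then have "real (card (N v)) > 0" using finN by (simp add: card_gt_0_iff)
    then show ?thesis using le[OF that] by (simp add: field_simps)
  qed simp
  then have "majority_colouring k D c"
    by (simp add: majority_colouring_def out_degree_eq_card_out_neighbours N_def)
  with c show ?thesis by blast
qed

end
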